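(* Let $A,B$ be positive bounded linear operators on a complex Hilbert space $\mathscr{H}$ such that $AB$ is a contraction (i.e. $\|AB\|\le1$). Then for all real $p\ge2$, $$w^{2p}(AB)\le\left[\|A^p\|-\ell\!\left(\bigl|A-\|A\|1_{\mathscr{H}}\bigr|^p\right)\right]\cdot\left[\|B^p\|-\ell\!\left(\bigl|B-\|B\|1_{\mathscr{H}}\bigr|^p\right)\right].$$ In particular, for every positive contraction $A$ on $\mathscr{H}$ and all real $p\ge2$, $$w^{2p}(A)\le\|A^p\|-\ell\!\left(\bigl|A-\|A\|1_{\mathscr{H}}\bigr|^p\right).$$
   Context: An operator $A$ is positive if $\langle Ax,x\rangle\ge0$ for all $x\in\mathscr{H}$. For a bounded linear operator $T$ on $\mathscr{H}$: $w(T)=\sup\{|\langle Tx,x\rangle|:\|x\|=1\}$ is the numerical radius, $w^{2p}(T)=(w(T))^{2p}$, $\|T\|$ is the operator norm, $|T|=(T^*T)^{1/2}$, and $\ell(T)=\inf\{\|Tx\|: x\in\mathscr{H},\ \|x\|=1\}$. Real powers of positive operators are defined by the continuous functional calculus, and $1_{\mathscr{H}}$ is the identity operator. *)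

theory Defs
  imports "HOL-Analysis.Analysis" "HOL-Computational_Algebra.Polynomial"
begin

class complex_vector = real_vector +
  fixes scaleC :: "complex \<Rightarrow> 'a \<Rightarrow> 'a" (infixr "*\<^sub>C" 75)
  assumes scaleC_add_right: "c *\<^sub>C (x + y) = c *\<^sub>C x + c *\<^sub>C y"
    and scaleC_add_left: "(c + d) *\<^sub>C x = c *\<^sub>C x + d *\<^sub>C x"
    and scaleC_scaleC: "c *\<^sub>C d *\<^sub>C x = (c * d) *\<^sub>C x"
    and scaleC_one: "1 *\<^sub>C x = x"
    and scaleR_scaleC: "r *\<^sub>R x = complex_of_real r *\<^sub>C x"

text \<open>The inner product is linear in its first and conjugate-linear in its second argument.\<close>

class complex_inner = complex_vector + real_normed_vector +
  fixes cinner :: "'a \<Rightarrow> 'a \<Rightarrow> complex"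
  assumes cinner_commute: "cinner x y = cnj (cinner y x)"
    and cinner_add_left: "cinner (x + y) z = cinner x z + cinner y z"
    and cinner_scaleC_left: "cinner (c *\<^sub>C x) y = c * cinner x y"
    and cinner_ge_zero: "0 \<le> Re (cinner x x)"
    and cinner_eq_zero_iff: "cinner x x = 0 \<longleftrightarrow> x = 0"
    and norm_eq_sqrt_cinner: "norm x = sqrt (Re (cinner x x))"

class complex_hilbert = complex_inner + complete_space

instantiation complex :: complex_hilbert
begin

definition scaleC_complex_def: "scaleC c (x::complex) = c * x"

definition cinner_complex_def: "cinner x (y::complex) = x * cnj y"

instance
proof
  fix x y z c d :: complex and r :: real
  show "c *\<^sub>C (x + y) = c *\<^sub>C x + c *\<^sub>C y" "(c + d) *\<^sub>C x = c *\<^sub>C x + d *\<^sub>C x"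
    "c *\<^sub>C d *\<^sub>C x = (c * d) *\<^sub>C x" "1 *\<^sub>C x = x"
    by (simp_all add: scaleC_complex_def algebra_simps)
  show "r *\<^sub>R x = complex_of_real r *\<^sub>C x"
    by (simp add: scaleC_complex_def scaleR_conv_of_real)
  show "cinner x y = cnj (cinner y x)" "cinner (x + y) z = cinner x z + cinner y z"
    "cinner (c *\<^sub>C x) y = c * cinner x y" "0 \<le> Re (cinner x x)"
    "cinner x x = 0 \<longleftrightarrow> x = 0"
    by (simp_all add: cinner_complex_def scaleC_complex_def algebra_simps)
  show "norm x = sqrt (Re (cinner x x))"
    by (simp add: cinner_complex_def cmod_def power2_eq_square)
qed

end

text \<open>
  Elements of \<^typ>\<open>'a \<Rightarrow>\<^sub>L 'a\<close> are the bounded real-linear maps. A bounded linear operator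
  on a complex Hilbert space is such a map that is also complex-linear; its operator norm is the
  norm of the type \<^typ>\<open>'a \<Rightarrow>\<^sub>L 'a\<close>.
\<close>

definition clinear_op :: "('a::complex_hilbert \<Rightarrow>\<^sub>L 'a) \<Rightarrow> bool" where
  "clinear_op T \<longleftrightarrow> (\<forall>c x. T (c *\<^sub>C x) = c *\<^sub>C T x)"

definition positive_op :: "('a::complex_hilbert \<Rightarrow>\<^sub>L 'a) \<Rightarrow> bool" where
  "positive_op T \<longleftrightarrow> clinear_op T \<and> (\<forall>x. cinner (T x) x \<in> \<real>\<^sub>\<ge>\<^sub>0)"

definition adjoint_op :: "('a::complex_hilbert \<Rightarrow>\<^sub>L 'a) \<Rightarrow> ('a \<Rightarrow>\<^sub>L 'a)" where
  "adjoint_op T = (THE S :: 'a \<Rightarrow>\<^sub>L 'a. \<forall>x y. cinner (T x) y = cinner x (S y))"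

text \<open>Over the zero space the supremum and infimum below range over the empty set and are
  unspecified.\<close>

definition numerical_radius :: "('a::complex_hilbert \<Rightarrow>\<^sub>L 'a) \<Rightarrow> real" where
  "numerical_radius T = (SUP x\<in>{x. norm x = 1}. cmod (cinner (T x) x))"

definition lower_bound_op :: "('a::complex_hilbert \<Rightarrow>\<^sub>L 'a) \<Rightarrow> real" where
  "lower_bound_op T = (INF x\<in>{x. norm x = 1}. norm (T x))"

text \<open>The inverse of a complex-linear map is complex-linear, so for complex-linear \<open>T\<close> it is
  immaterial that \<open>S\<close> is only required to be a bounded real-linear map.\<close>

definition spectrum_op :: "('a::complex_hilbert \<Rightarrow>\<^sub>L 'a) \<Rightarrow> complex set" where
  "spectrum_op T = {z. \<not> (\<exists>S :: 'a \<Rightarrow>\<^sub>L 'a.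
     (\<forall>x. S (T x - z *\<^sub>C x) = x) \<and> (\<forall>y. T (S y) - z *\<^sub>C S y = y))}"

definition poly_op :: "real poly \<Rightarrow> ('a::complex_hilbert \<Rightarrow>\<^sub>L 'a) \<Rightarrow> ('a \<Rightarrow>\<^sub>L 'a)" where
  "poly_op q T = (\<Sum>i\<le>degree q. coeff q i *\<^sub>R (((o\<^sub>L) T ^^ i) id_blinfun))"

text \<open>
  For self-adjoint \<open>T\<close> (whose spectrum is a compact subset of the real line) and real-valued \<open>f\<close>
  continuous on the spectrum, \<open>f(T)\<close> is the operator-norm limit of \<open>q\<^sub>n(T)\<close> for any real
  polynomials \<open>q\<^sub>n\<close> converging to \<open>f\<close> uniformly on the spectrum. The limit exists and does not
  depend on the approximating sequence. For other \<open>T\<close> or \<open>f\<close> the value is not meaningful.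
\<close>

definition cfc :: "(real \<Rightarrow> real) \<Rightarrow> ('a::complex_hilbert \<Rightarrow>\<^sub>L 'a) \<Rightarrow> ('a \<Rightarrow>\<^sub>L 'a)" where
  "cfc f T = (THE S. \<exists>q :: nat \<Rightarrow> real poly.
     uniform_limit {t. complex_of_real t \<in> spectrum_op T} (\<lambda>n. poly (q n)) f sequentially \<and>
     (\<lambda>n. poly_op (q n) T) \<longlonglongrightarrow> S)"

text \<open>Powers of positive operators, for exponents \<open>p > 0\<close>: then \<open>0 powr p = 0\<close> and
  \<open>\<lambda>t. t powr p\<close> is continuous on \<open>[0, \<infinity>)\<close>.\<close>

definition powr_op :: "('a::complex_hilbert \<Rightarrow>\<^sub>L 'a) \<Rightarrow> real \<Rightarrow> ('a \<Rightarrow>\<^sub>L 'a)" where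
  "powr_op T p = cfc (\<lambda>t. t powr p) T"

definition abs_op :: "('a::complex_hilbert \<Rightarrow>\<^sub>L 'a) \<Rightarrow> ('a \<Rightarrow>\<^sub>L 'a)" where
  "abs_op T = powr_op (adjoint_op T o\<^sub>L T) (1/2)"

end

theory Submission
  imports Defs "HOL-Computational_Algebra.Fundamental_Theorem_Algebra"
begin

text \<open>
  The norm of a positive operator \<open>A\<close> is an approximate eigenvalue of \<open>A\<close>: there are unit vectors
  \<open>x\<^sub>n\<close> with \<open>A x\<^sub>n - \<parallel>A\<parallel> x\<^sub>n\<close> tending to \<open>0\<close>. Continuous functions act on approximate eigenvectors
  through the value at the eigenvalue, so \<open>\<parallel>A\<^sup>p\<parallel> \<ge> \<parallel>A\<parallel>\<^sup>p\<close> and the subtracted term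
  \<open>\<ell>(|A - \<parallel>A\<parallel>|\<^sup>p)\<close> vanishes. What remains is
  \<open>w(AB)\<^sup>2\<^sup>p \<le> \<parallel>AB\<parallel>\<^sup>2\<^sup>p \<le> \<parallel>AB\<parallel>\<^sup>p \<le> \<parallel>A\<parallel>\<^sup>p \<parallel>B\<parallel>\<^sup>p\<close>.
  The functional calculus is well defined on self-adjoint \<open>T\<close> because \<open>\<parallel>q(T)\<parallel>\<close> is, for every real
  polynomial \<open>q\<close>, the value of \<open>\<bar>q\<bar>\<close> at some real point of the spectrum.
\<close>

instance complex_hilbert \<subseteq> banach ..

section \<open>Inner products and self-adjoint operators\<close>

lemma cinner_add_right: "cinner x (y + z) = cinner x y + cinner x z"
  by (metis cinner_add_left cinner_commute complex_cnj_add)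

lemma cinner_scaleC_right: "cinner x (c *\<^sub>C y) = cnj c * cinner x y"
  by (metis cinner_commute cinner_scaleC_left complex_cnj_mult)

lemma cinner_scaleR_left: "cinner (r *\<^sub>R x) y = of_real r * cinner x y"
  by (simp add: scaleR_scaleC cinner_scaleC_left)

lemma cinner_scaleR_right: "cinner x (r *\<^sub>R y) = of_real r * cinner x y"
  by (simp add: scaleR_scaleC cinner_scaleC_right)

lemma cinner_zero_left [simp]: "cinner 0 y = 0"
  using cinner_scaleR_left[of 0 0 y] by simp

lemma cinner_zero_right [simp]: "cinner x 0 = 0"
  using cinner_scaleR_right[of x 0 0] by simp

lemma cinner_diff_left: "cinner (x - y) z = cinner x z - cinner y z"
  using cinner_add_left[of "x - y" y z] by simp

lemma cinner_diff_right: "cinner x (y - z) = cinner x y - cinner x z"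
  using cinner_add_right[of x "y - z" z] by simp

lemmas cinner_simps = cinner_add_left cinner_add_right cinner_diff_left cinner_diff_right
  cinner_scaleR_left cinner_scaleR_right

lemma power2_norm_eq_cinner: "(norm x)\<^sup>2 = Re (cinner x x)"
  using cinner_ge_zero[of x] by (simp add: norm_eq_sqrt_cinner)

lemma cinner_self: "cinner x x = of_real ((norm x)\<^sup>2)"
proof -
  have "Im (cinner x x) = 0"
    using cinner_commute[of x x] by (metis cnj.simps(2) equation_minus_iff neg_equal_zero)
  then show ?thesis by (simp add: complex_eq_iff power2_norm_eq_cinner)
qed

lemma cinner_Cauchy_Schwarz: "cmod (cinner x y) \<le> norm x * norm y"
proof (cases "y = 0")
  case False
  define n where "n = (norm y)\<^sup>2"
  define c where "c = cinner x y"
  have n: "n > 0" using False by (simp add: n_def)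
  have cc: "c * cnj c = (complex_of_real (cmod c))\<^sup>2"
    by (simp add: complex_norm_square flip: of_real_power)
  have yx: "cinner y x = cnj c" using cinner_commute c_def by metis
  \<comment> \<open>This vector is \<open>n\<close> times the component of \<open>x\<close>
    orthogonal to \<open>y\<close>; the scaling avoids division.\<close>
  have "cinner (n *\<^sub>R x - c *\<^sub>C y) (n *\<^sub>R x - c *\<^sub>C y)
      = of_real (n * (n * (norm x)\<^sup>2 - (cmod c)\<^sup>2))"
    by (simp add: cinner_simps cinner_scaleC_left cinner_scaleC_right yx flip: c_def)
      (simp add: cinner_self cc algebra_simps flip: n_def)
  then have "0 \<le> n * (n * (norm x)\<^sup>2 - (cmod c)\<^sup>2)"
    using cinner_ge_zero by (metis Re_complex_of_real)
  then have "(cmod c)\<^sup>2 \<le> (norm x * norm y)\<^sup>2"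
    using n by (simp add: zero_le_mult_iff n_def power_mult_distrib mult.commute)
  then show ?thesis by (simp add: c_def power2_le_iff_abs_le abs_mult)
qed simp

lemma bounded_linear_cinner_left: "bounded_linear (\<lambda>x. cinner x y)"
  by (rule bounded_linear_intro[where K = "norm y"])
    (simp_all add: cinner_add_left cinner_scaleR_left scaleR_conv_of_real cinner_Cauchy_Schwarz)

lemma bounded_linear_cinner_right: "bounded_linear (\<lambda>y. cinner x y)"
  by (rule bounded_linear_intro[where K = "norm x"])
    (simp_all add: cinner_add_right cinner_scaleR_right scaleR_conv_of_real,
      metis cinner_Cauchy_Schwarz mult.commute)

lemma cinner_eq_all_imp_eq: "(\<And>x. cinner x y = cinner x z) \<Longrightarrow> y = z"
  using cinner_eq_zero_iff[of "y - z"] by (simp add: cinner_diff_right)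

text \<open>Phrased without \<open>adjoint_op\<close>, so that no existence of adjoints has to be
  settled first. The identity forces complex linearity of \<open>T\<close>, because its right-hand
  side is complex-linear in \<open>x\<close>.\<close>

definition self_adjoint :: "('a::complex_hilbert \<Rightarrow>\<^sub>L 'a) \<Rightarrow> bool" where
  "self_adjoint T \<longleftrightarrow> (\<forall>x y. cinner (T x) y = cinner x (T y))"

lemma self_adjointD: "self_adjoint T \<Longrightarrow> cinner (T x) y = cinner x (T y)"
  by (simp add: self_adjoint_def)

lemma self_adjoint_limit:
  assumes "\<And>n. self_adjoint (S n)" "S \<longlonglongrightarrow> T"
  shows "self_adjoint T"
  unfolding self_adjoint_def
proof (intro allI)
  fix x y
  have ap: "(\<lambda>n. S n z) \<longlonglongrightarrow> T z" for z
    using assms(2) by (intro tendsto_intros)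
  have "(\<lambda>n. cinner (S n x) y) \<longlonglongrightarrow> cinner (T x) y"
    by (rule bounded_linear.tendsto[OF bounded_linear_cinner_left ap])
  moreover have "(\<lambda>n. cinner (S n x) y) \<longlonglongrightarrow> cinner x (T y)"
    using bounded_linear.tendsto[OF bounded_linear_cinner_right ap[of y], of x]
    by (simp add: self_adjointD[OF assms(1)])
  ultimately show "cinner (T x) y = cinner x (T y)"
    by (rule LIMSEQ_unique)
qed

lemma self_adjoint_diff_id:
  "self_adjoint T \<Longrightarrow> self_adjoint (T - r *\<^sub>R id_blinfun)"
  by (simp add: self_adjoint_def blinfun.bilinear_simps cinner_simps)

text \<open>Polarization: a sesquilinear form vanishing on the diagonal vanishes.\<close>

lemma positive_op_self_adjoint:
  assumes "positive_op T"
  shows "self_adjoint T"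
  unfolding self_adjoint_def
proof (intro allI)
  fix x y
  have cl: "T (c *\<^sub>C z) = c *\<^sub>C T z" for c z
    using assms by (simp add: positive_op_def clinear_op_def)
  define h where "h u v = cinner (T u) v - cinner u (T v)" for u v
  have diag: "h u u = 0" for u
  proof -
    have "cinner (T u) u \<in> \<real>\<^sub>\<ge>\<^sub>0" using assms by (simp add: positive_op_def)
    then have "cnj (cinner (T u) u) = cinner (T u) u"
      by (metis complex_cnj_complex_of_real nonneg_Reals_cases)
    then show ?thesis using cinner_commute[of u "T u"] by (simp add: h_def)
  qed
  have "h (x + y) (x + y) = h x x + h x y + h y x + h y y"
    by (simp add: h_def blinfun.bilinear_simps cinner_simps)
  then have 1: "h x y + h y x = 0" by (simp add: diag)
  have "h (\<i> *\<^sub>C x + y) (\<i> *\<^sub>C x + y) = h x x + \<i> * h x y - \<i> * h y x + h y y"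
    by (simp add: h_def blinfun.bilinear_simps cinner_simps cl cinner_scaleC_left
        cinner_scaleC_right algebra_simps)
  then have "\<i> * (h x y - h y x) = 0" by (simp add: diag algebra_simps)
  then have "h x y = 0" using 1 by simp
  then show "cinner (T x) y = cinner x (T y)" by (simp add: h_def)
qed

text \<open>\<open>T\<close> is its own witness, and nondegeneracy of the inner product gives the
  uniqueness that the definite description requires.\<close>

lemma adjoint_op_self_adjoint:
  assumes "self_adjoint T"
  shows "adjoint_op T = T"
  unfolding adjoint_op_def
proof (rule the_equality)
  show "\<forall>x y. cinner (T x) y = cinner x (T y)"
    using assms by (simp add: self_adjoint_def)
  fix S :: "'a \<Rightarrow>\<^sub>L 'a" assume "\<forall>x y. cinner (T x) y = cinner x (S y)"
  then have "cinner x (S y) = cinner x (T y)" for x y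
    using self_adjointD[OF assms] by metis
  then show "S = T"
    by (metis blinfun_eqI cinner_eq_all_imp_eq)
qed

section \<open>Polynomials of an operator\<close>

lemma poly_op_eq_sum:
  assumes "degree q \<le> n"
  shows "poly_op q T = (\<Sum>i\<le>n. coeff q i *\<^sub>R (((o\<^sub>L) T ^^ i) id_blinfun))"
  unfolding poly_op_def using assms
  by (intro sum.mono_neutral_left) (auto simp: coeff_eq_0)

lemma poly_op_0 [simp]: "poly_op 0 T = 0"
  by (simp add: poly_op_def)

text \<open>Horner's recursion. It reduces the algebraic rules below to induction on polynomials,
  without handling powers of \<open>T\<close>.\<close>

lemma poly_op_pCons: "poly_op (pCons a p) T x = a *\<^sub>R x + T (poly_op p T x)"
proof -
  have "poly_op (pCons a p) T
      = a *\<^sub>R id_blinfun + (\<Sum>i\<le>degree p. coeff p i *\<^sub>R (T o\<^sub>L ((o\<^sub>L) T ^^ i) id_blinfun))"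
    by (subst poly_op_eq_sum[OF degree_pCons_le]) (simp add: sum.atMost_Suc_shift del: sum.atMost_Suc)
  then show ?thesis
    by (simp add: poly_op_def blinfun.bilinear_simps blinfun.sum_left blinfun.sum_right)
qed

lemma poly_op_add: "poly_op (p + q) T = poly_op p T + poly_op q T"
proof (rule blinfun_eqI)
  show "poly_op (p + q) T x = (poly_op p T + poly_op q T) x" for x
    by (induction p q rule: poly_induct2)
      (simp_all add: poly_op_pCons blinfun.bilinear_simps algebra_simps)
qed

lemma poly_op_smult: "poly_op (smult c p) T = c *\<^sub>R poly_op p T"
proof (rule blinfun_eqI)
  show "poly_op (smult c p) T x = (c *\<^sub>R poly_op p T) x" for x
    by (induction p) (simp_all add: poly_op_pCons blinfun.bilinear_simps algebra_simps)
qed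

lemma poly_op_diff: "poly_op (p - q) T = poly_op p T - poly_op q T"
  using poly_op_add[of "p - q" q T] by simp

lemma poly_op_mult: "poly_op (p * q) T x = poly_op p T (poly_op q T x)"
  by (induction p)
    (simp_all add: poly_op_pCons poly_op_add poly_op_smult blinfun.bilinear_simps)

lemma self_adjoint_poly_op:
  fixes T :: "'a::complex_hilbert \<Rightarrow>\<^sub>L 'a"
  assumes "self_adjoint T"
  shows "self_adjoint (poly_op q T)"
proof -
  have "cinner (poly_op q T x) y = cinner x (poly_op q T y)" for x y
  proof (induction q arbitrary: x y)
    case (pCons a q)
    \<comment> \<open>\<open>[:0, 1:]\<close> evaluates to \<open>T\<close>, so commutativity of
      polynomial multiplication makes \<open>T\<close> commute with
      \<open>poly_op q T\<close>.\<close>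
    have "T (poly_op q T y) = poly_op q T (T y)"
      using poly_op_mult[of q "[:0, 1:]" T y] poly_op_mult[of "[:0, 1:]" q T y]
      by (simp add: poly_op_pCons mult.commute)
    then show ?case
      using pCons.IH by (simp add: poly_op_pCons cinner_simps self_adjointD[OF assms])
  qed simp
  then show ?thesis by (simp add: self_adjoint_def)
qed

section \<open>Operators that are bounded below\<close>

text \<open>Failure of this property for \<open>T - t\<close> says that \<open>t\<close> is an
  approximate eigenvalue of \<open>T\<close>. It stands in for noninvertibility because it directly
  yields approximate eigenvectors.\<close>

definition bounded_below :: "('a::complex_hilbert \<Rightarrow>\<^sub>L 'a) \<Rightarrow> bool" where
  "bounded_below T \<longleftrightarrow> (\<exists>c>0. \<forall>x. c * norm x \<le> norm (T x))"

lemma bounded_below_compose: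
  fixes R S T :: "'a::complex_hilbert \<Rightarrow>\<^sub>L 'a"
  assumes "bounded_below S" "bounded_below T" "\<And>x. R x = S (T x)"
  shows "bounded_below R"
proof -
  obtain c d where "c > 0" "d > 0" and c: "\<And>x. c * norm x \<le> norm (S x)"
    and d: "\<And>x. d * norm x \<le> norm (T x)"
    using assms(1,2) by (auto simp: bounded_below_def)
  have "(c * d) * norm x \<le> norm (R x)" for x
    using order_trans[OF mult_left_mono[OF d[of x], of c] c[of "T x"]] \<open>c > 0\<close>
    by (simp add: assms(3) mult.assoc)
  then show ?thesis
    unfolding bounded_below_def using \<open>c > 0\<close> \<open>d > 0\<close> by (intro exI[of _ "c * d"]) simp
qed

text \<open>Cauchy-Schwarz turns a lower bound on the quadratic form into one on
  \<open>norm (T x)\<close>.\<close>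

lemma bounded_below_cinnerI:
  fixes T :: "'a::complex_hilbert \<Rightarrow>\<^sub>L 'a"
  assumes "c > 0" "\<And>x. c * (norm x)\<^sup>2 \<le> Re (cinner (T x) x)"
  shows "bounded_below T"
proof -
  have "c * norm x \<le> norm (T x)" for x
  proof (cases "x = 0")
    case False
    have "(c * norm x) * norm x \<le> norm (T x) * norm x"
      using assms(2)[of x] complex_Re_le_cmod[of "cinner (T x) x"] cinner_Cauchy_Schwarz[of "T x" x]
      by (simp add: power2_eq_square mult.assoc)
    then show ?thesis using False by simp
  qed simp
  then show ?thesis using \<open>c > 0\<close> by (auto simp: bounded_below_def)
qed

lemma not_bounded_below_sequence:
  fixes T :: "'a::complex_hilbert \<Rightarrow>\<^sub>L 'a"
  assumes "\<not> bounded_below T"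
  obtains X where "\<And>n. norm (X n) = 1" "(\<lambda>n::nat. T (X n)) \<longlonglongrightarrow> 0"
proof -
  have "\<exists>x. norm x = 1 \<and> norm (T x) \<le> inverse (real (Suc n))" for n
  proof -
    have "inverse (real (Suc n)) > 0" by simp
    \<comment> \<open>The constant \<open>1/(n+1)\<close> fails at some \<open>x\<close>; strictness
      makes \<open>x\<close> nonzero, so it can be normalized.\<close>
    then obtain x where x: "norm (T x) < inverse (real (Suc n)) * norm x"
      using assms unfolding bounded_below_def by (meson not_le)
    then have "x \<noteq> 0" by auto
    moreover have "norm (T (inverse (norm x) *\<^sub>R x)) \<le> inverse (real (Suc n))"
      using x \<open>x \<noteq> 0\<close> by (simp add: blinfun.bilinear_simps field_simps)
    ultimately show ?thesis
      by (intro exI[of _ "inverse (norm x) *\<^sub>R x"]) simp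
  qed
  then obtain X where X: "\<And>n. norm (X n) = 1" "\<And>n. norm (T (X n)) \<le> inverse (real (Suc n))"
    by metis
  have "(\<lambda>n. T (X n)) \<longlonglongrightarrow> 0"
    by (rule Lim_null_comparison[OF _ LIMSEQ_inverse_real_of_nat]) (intro always_eventually allI X(2))
  with X(1) show ?thesis by (rule that)
qed

section \<open>Real factorization and the norm of a polynomial in a self-adjoint operator\<close>

lemma map_poly_of_real_add:
  "map_poly of_real (p + q) = (map_poly of_real p + map_poly of_real q :: complex poly)"
  by (simp add: poly_eq_iff coeff_map_poly)

lemma map_poly_of_real_mult:
  "map_poly of_real (p * q) = (map_poly of_real p * map_poly of_real q :: complex poly)"
  by (simp add: poly_eq_iff coeff_map_poly coeff_mult)

text \<open>Take a complex root: if real it splits off a linear factor, otherwise a quadratic one.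
  Writing the quadratic as a square plus \<open>b^2\<close> exhibits its positivity on self-adjoint
  operators.\<close>

lemma real_poly_linear_or_quadratic_factor:
  fixes g :: "real poly"
  assumes "degree g > 0"
  obtains r h where "g = h * [:-r, 1:]"
  | a b h where "b \<noteq> 0" "g = h * ([:-a, 1:] * [:-a, 1:] + [:b\<^sup>2:])"
proof -
  let ?C = "map_poly complex_of_real"
  have "degree (?C g) = degree g"
    by (rule degree_map_poly) simp
  then have "\<not> constant (poly (?C g))"
    using assms by (simp add: constant_degree)
  then obtain z where z: "poly (?C g) z = 0"
    using fundamental_theorem_of_algebra by blast
  show thesis
  proof (cases "Im z = 0")
    case True
    then have "poly (?C g) (of_real (Re z)) = of_real (poly g (Re z))"
      by (induction g) (simp_all add: map_poly_pCons)
    moreover have "of_real (Re z) = z" using True by (simp add: complex_eq_iff)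
    ultimately have "poly g (Re z) = 0" using z by simp
    then obtain h where "g = [:-Re z, 1:] * h"
      by (auto simp: poly_eq_0_iff_dvd elim: dvdE)
    then show thesis using that(1)[of h "Re z"] by (simp only: mult.commute)
  next
    case False
    define d where "d = [:-Re z, 1:] * [:-Re z, 1:] + [:(Im z)\<^sup>2:]"
    have d: "d = [:(Re z)\<^sup>2 + (Im z)\<^sup>2, - 2 * Re z, 1:]"
      by (simp add: d_def power2_eq_square)
    \<comment> \<open>\<open>d\<close> is the minimal polynomial of \<open>z\<close> over the reals.
      The remainder has degree at most 1 and vanishes at the nonreal \<open>z\<close>, hence is
      zero.\<close>
    define r where "r = g mod d"
    have dz: "poly (?C d) z = 0"
      by (simp add: d map_poly_pCons complex_eq_iff power2_eq_square algebra_simps)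
    have g: "g = (g div d) * d + r" by (simp add: r_def)
    have "poly (?C r) z = 0"
      using z dz by (subst (asm) g) (simp add: map_poly_of_real_add map_poly_of_real_mult)
    moreover have "d \<noteq> 0" "degree d = 2" by (simp_all add: d)
    then have "degree r \<le> 1"
      using degree_mod_less[of d g] by (auto simp: r_def)
    then obtain u v where r: "r = [:u, v:]"
      by (metis One_nat_def degree_eq_zeroE degree_pCons_eq_if le_Suc_eq le_zero_eq pCons_cases
          nat.inject pCons_0_0)
    ultimately have "v = 0 \<and> u = 0"
      using False by (auto simp: map_poly_pCons complex_eq_iff)
    then have "g = (g div d) * d" using g r by simp
    then show thesis unfolding d_def by (rule that(2)[OF False])
  qed
qed

text \<open>Factors are split off one at a time, and composition preserves bounded-belowness: linear
  factors come from real roots and fall under the hypothesis, quadratic ones are bounded below by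
  positivity.\<close>

lemma bounded_below_poly_op:
  fixes T :: "'a::complex_hilbert \<Rightarrow>\<^sub>L 'a"
  assumes "self_adjoint T" "g \<noteq> 0"
    and "\<And>t. poly g t = 0 \<Longrightarrow> bounded_below (T - t *\<^sub>R id_blinfun)"
  shows "bounded_below (poly_op g T)"
  using assms(2,3)
proof (induction "degree g" arbitrary: g rule: less_induct)
  case less
  show ?case
  proof (cases "degree g = 0")
    case True
    then obtain c where "g = [:c:]" by (rule degree_eq_zeroE)
    then show ?thesis using less.prems(1)
      unfolding bounded_below_def by (intro exI[of _ "\<bar>c\<bar>"]) (simp add: poly_op_pCons)
  next
    case False
    then have "degree g > 0" by simp
    then show ?thesis
    proof (cases rule: real_poly_linear_or_quadratic_factor)
      case (1 r h)
      then have "h \<noteq> 0" using less.prems(1) by auto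
      then have "degree h < degree g" unfolding 1 by (subst degree_mult_eq) auto
      then have "bounded_below (poly_op h T)"
        using less.hyps \<open>h \<noteq> 0\<close> less.prems(2) 1 by simp
      moreover have "bounded_below (T - r *\<^sub>R id_blinfun)"
        using less.prems(2) 1 by simp
      ultimately show ?thesis
        by (rule bounded_below_compose)
          (simp only: 1 poly_op_mult, simp add: poly_op_pCons blinfun.bilinear_simps)
    next
      case (2 a b h)
      let ?d = "[:-a, 1:] * [:-a, 1:] + [:b\<^sup>2:]"
      let ?Ta = "T - a *\<^sub>R id_blinfun"
      have "h \<noteq> 0" using less.prems(1) 2 by auto
      moreover have "?d \<noteq> 0" "degree ?d = 2" by simp_all
      ultimately have "degree h < degree g" unfolding 2(2) by (subst degree_mult_eq) auto
      then have "bounded_below (poly_op h T)"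
        using less.hyps \<open>h \<noteq> 0\<close> less.prems(2) 2(2) by (metis mult_eq_0_iff poly_mult)
      moreover have "bounded_below (poly_op ?d T)"
      proof (rule bounded_below_cinnerI)
        show "b\<^sup>2 > 0" using 2 by simp
        fix x
        have "poly_op [:-a, 1:] T y = ?Ta y" for y
          by (simp add: poly_op_pCons blinfun.bilinear_simps)
        then have "poly_op ?d T x = ?Ta (?Ta x) + b\<^sup>2 *\<^sub>R x"
          by (simp only: poly_op_add poly_op_mult blinfun.add_left) (simp add: poly_op_pCons)
        \<comment> \<open>Self-adjointness moves one factor across; the square contributes a
          nonnegative term, leaving \<open>b^2\<close> as lower bound.\<close>
        then have "cinner (poly_op ?d T x) x = cinner (?Ta x) (?Ta x) + of_real (b\<^sup>2) * cinner x x"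
          using self_adjointD[OF self_adjoint_diff_id[OF assms(1)]]
          by (simp only: cinner_add_left cinner_scaleR_left)
        then show "b\<^sup>2 * (norm x)\<^sup>2 \<le> Re (cinner (poly_op ?d T x) x)"
          by (simp add: cinner_self)
      qed
      ultimately show ?thesis
        by (rule bounded_below_compose) (simp only: 2(2) poly_op_mult)
    qed
  qed
qed

text \<open>A lower bound \<open>d\<close> for \<open>R^2 - c^2\<close>, with
  \<open>c = norm R\<close>, would improve the bound on \<open>norm (R x)\<close> by a fixed factor
  and contradict that \<open>c\<close> is the operator norm.\<close>

lemma not_bounded_below_square_diff:
  fixes R :: "'a::complex_hilbert \<Rightarrow>\<^sub>L 'a"
  assumes "\<exists>x::'a. x \<noteq> 0" "self_adjoint R"
  shows "\<not> bounded_below ((R o\<^sub>L R) - (norm R)\<^sup>2 *\<^sub>R id_blinfun)"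
proof
  define c where "c = norm R"
  assume "bounded_below ((R o\<^sub>L R) - (norm R)\<^sup>2 *\<^sub>R id_blinfun)"
  then obtain d where d: "d > 0" "\<And>x. d * norm x \<le> norm (R (R x) - c\<^sup>2 *\<^sub>R x)"
    by (auto simp: bounded_below_def blinfun.bilinear_simps c_def)
  \<comment> \<open>Expand the squared norm of \<open>R (R x) - c^2 x\<close>, use
    \<open>cinner (R (R x)) x = cinner (R x) (R x)\<close>, and bound \<open>norm (R (R x))\<close>
    by \<open>c * norm (R x)\<close>.\<close>
  have key: "d\<^sup>2 * (norm x)\<^sup>2 \<le> c\<^sup>2 * (c\<^sup>2 * (norm x)\<^sup>2 - (norm (R x))\<^sup>2)" for x
  proof -
    have "cinner (R (R x)) x = cinner (R x) (R x)" "cinner x (R (R x)) = cinner (R x) (R x)"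
      by (simp_all add: self_adjointD[OF assms(2)])
    then have "(norm (R (R x) - c\<^sup>2 *\<^sub>R x))\<^sup>2
        = (norm (R (R x)))\<^sup>2 - 2 * c\<^sup>2 * (norm (R x))\<^sup>2 + c\<^sup>2 * (c\<^sup>2 * (norm x)\<^sup>2)"
      by (simp add: power2_norm_eq_cinner cinner_simps algebra_simps flip: of_real_power)
    moreover have "(norm (R (R x)))\<^sup>2 \<le> c\<^sup>2 * (norm (R x))\<^sup>2"
      using power_mono[OF norm_blinfun[of R "R x"], of 2] by (simp add: c_def power_mult_distrib)
    moreover have "d\<^sup>2 * (norm x)\<^sup>2 \<le> (norm (R (R x) - c\<^sup>2 *\<^sub>R x))\<^sup>2"
      using power_mono[OF d(2)[of x], of 2] d(1) by (simp add: power_mult_distrib)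
    ultimately show ?thesis by (simp add: algebra_simps)
  qed
  obtain x :: 'a where x: "x \<noteq> 0" using assms(1) by blast
  have "c > 0"
  proof (rule ccontr)
    assume "\<not> c > 0"
    then have "c = 0" by (simp add: c_def)
    then show False using key[of x] d(1) x by (simp add: mult_le_0_iff)
  qed
  \<comment> \<open>Dividing \<open>key\<close> by \<open>c^2\<close> gives this improved constant,
    strictly below \<open>c^2\<close>.\<close>
  define e where "e = c\<^sup>2 - d\<^sup>2 / c\<^sup>2"
  have le: "(norm (R y))\<^sup>2 \<le> e * (norm y)\<^sup>2" for y
    using key[of y] \<open>c > 0\<close> by (simp add: e_def field_simps)
  have "0 \<le> e * (norm x)\<^sup>2"
    using le[of x] zero_le_power2 order_trans by blast
  then have "e \<ge> 0" using x by (simp add: zero_le_mult_iff)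
  have "c \<le> sqrt e"
    unfolding c_def
  proof (rule norm_blinfun_bound)
    show "norm (R y) \<le> sqrt e * norm y" for y
      using real_sqrt_le_mono[OF le[of y]] by (simp add: real_sqrt_mult)
  qed (use \<open>e \<ge> 0\<close> in simp)
  then have "c\<^sup>2 \<le> e"
    using \<open>c > 0\<close> \<open>e \<ge> 0\<close> by (metis less_imp_le power_mono real_sqrt_pow2)
  moreover have "d\<^sup>2 / c\<^sup>2 > 0" using d(1) \<open>c > 0\<close> by simp
  ultimately show False by (simp add: e_def)
qed

text \<open>
  With \<open>c = \<parallel>q(T)\<parallel>\<close>, the operator \<open>q(T)\<^sup>2 - c\<^sup>2\<close> is not bounded below, hence neither is \<open>T - t\<close> for
  some real root \<open>t\<close> of \<open>q\<^sup>2 - c\<^sup>2\<close>.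
\<close>

lemma norm_poly_op_attained:
  fixes T :: "'a::complex_hilbert \<Rightarrow>\<^sub>L 'a"
  assumes "\<exists>x::'a. x \<noteq> 0" "self_adjoint T"
  obtains t where "\<not> bounded_below (T - t *\<^sub>R id_blinfun)" "\<bar>poly q t\<bar> = norm (poly_op q T)"
proof -
  have main: "\<exists>t. \<not> bounded_below (T - t *\<^sub>R id_blinfun) \<and> \<bar>poly q t\<bar> = norm (poly_op q T)"
    if nz: "q * q - [:(norm (poly_op q T))\<^sup>2:] \<noteq> 0" for q
  proof -
    let ?c = "norm (poly_op q T)"
    have "poly_op (q * q - [:?c\<^sup>2:]) T = (poly_op q T o\<^sub>L poly_op q T) - ?c\<^sup>2 *\<^sub>R id_blinfun"
      by (rule blinfun_eqI)
        (simp add: poly_op_diff poly_op_mult poly_op_pCons blinfun.bilinear_simps)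
    then have "\<not> bounded_below (poly_op (q * q - [:?c\<^sup>2:]) T)"
      using not_bounded_below_square_diff[OF assms(1) self_adjoint_poly_op[OF assms(2), of q]] by simp
    then obtain t where t: "\<not> bounded_below (T - t *\<^sub>R id_blinfun)" "poly (q * q - [:?c\<^sup>2:]) t = 0"
      using bounded_below_poly_op[OF assms(2) nz] by blast
    then have "(poly q t)\<^sup>2 = ?c\<^sup>2" by (simp add: power2_eq_square)
    then have "\<bar>poly q t\<bar> = ?c" using power2_eq_iff_nonneg[of "\<bar>poly q t\<bar>" ?c] by simp
    with t(1) show ?thesis by blast
  qed
  show thesis
  proof (cases "q * q - [:(norm (poly_op q T))\<^sup>2:] = 0")
    case True
    \<comment> \<open>Here \<open>q^2\<close> is constant, so any approximate eigenvalue serves.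
      Applying \<open>main\<close> to the polynomial \<open>[:0, 1:]\<close>, whose square is not
      constant, supplies one.\<close>
    have "[:0, 1:] * [:0, 1:] - [:(norm (poly_op [:0, 1:] T))\<^sup>2:] \<noteq> 0" by simp
    from main[OF this] obtain t where "\<not> bounded_below (T - t *\<^sub>R id_blinfun)" by blast
    moreover have "poly (q * q - [:(norm (poly_op q T))\<^sup>2:]) t = 0" by (simp only: True poly_0)
    then have "(poly q t)\<^sup>2 = (norm (poly_op q T))\<^sup>2" by (simp add: power2_eq_square)
    then have "\<bar>poly q t\<bar> = norm (poly_op q T)"
      using power2_eq_iff_nonneg[of "\<bar>poly q t\<bar>" "norm (poly_op q T)"] by simp
    ultimately show thesis by (rule that)
  qed (use main that in blast)
qed

section \<open>Real points of the spectrum\<close>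

lemma not_bounded_below_in_spectrum:
  fixes T :: "'a::complex_hilbert \<Rightarrow>\<^sub>L 'a"
  assumes "\<not> bounded_below (T - t *\<^sub>R id_blinfun)"
  shows "complex_of_real t \<in> spectrum_op T"
proof (rule ccontr)
  assume "complex_of_real t \<notin> spectrum_op T"
  then obtain S :: "'a \<Rightarrow>\<^sub>L 'a" where S: "\<And>x. S (T x - t *\<^sub>R x) = x"
    by (auto simp: spectrum_op_def scaleR_scaleC)
  \<comment> \<open>The added 1 allows inversion even if \<open>norm S = 0\<close>.\<close>
  have "norm S + 1 > 0" by (simp add: add_nonneg_pos)
  have "inverse (norm S + 1) * norm x \<le> norm ((T - t *\<^sub>R id_blinfun) x)" for x
  proof -
    have "norm x \<le> norm S * norm (T x - t *\<^sub>R x)"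
      using norm_blinfun[of S "T x - t *\<^sub>R x"] S[of x] by simp
    also have "\<dots> \<le> (norm S + 1) * norm (T x - t *\<^sub>R x)"
      by (intro mult_right_mono) simp_all
    finally show ?thesis
      using \<open>norm S + 1 > 0\<close> by (simp add: blinfun.bilinear_simps field_simps)
  qed
  moreover have "inverse (norm S + 1) > 0" using \<open>norm S + 1 > 0\<close> by simp
  ultimately show False using assms unfolding bounded_below_def by blast
qed

text \<open>The Neumann series \<open>S\<close> of powers of \<open>K\<close>: composing with
  \<open>K\<close> on either side shifts the series by one term.\<close>

lemma neumann_inverse:
  fixes K :: "'a::complex_hilbert \<Rightarrow>\<^sub>L 'a"
  assumes "norm K < 1"
  obtains S :: "'a \<Rightarrow>\<^sub>L 'a" where "\<And>x. S (x - K x) = x" "\<And>x. S x - K (S x) = x"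
proof -
  define P where "P n = ((o\<^sub>L) K ^^ n) id_blinfun" for n :: nat
  have P0: "P 0 = id_blinfun" and PS: "P (Suc n) = K o\<^sub>L P n" for n
    by (simp_all add: P_def)
  \<comment> \<open>Powers are built by composing on the left; this version is what makes
    \<open>S\<close> a left inverse too.\<close>
  have PS': "P (Suc n) = P n o\<^sub>L K" for n
  proof (induction n)
    case 0
    show ?case by (rule blinfun_eqI) (simp add: PS P0)
  next
    case (Suc n)
    have "P (Suc (Suc n)) = K o\<^sub>L (P n o\<^sub>L K)" by (simp only: PS[of "Suc n"] Suc)
    also have "\<dots> = P (Suc n) o\<^sub>L K" by (rule blinfun_eqI) (simp add: PS)
    finally show ?case .
  qed
  have "norm (P n) \<le> norm K ^ n" for n
  proof (induction n)
    case (Suc n)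
    have "norm (P (Suc n)) \<le> norm K * norm (P n)" by (simp add: PS norm_blinfun_compose)
    also have "\<dots> \<le> norm K * norm K ^ n" using Suc by (simp add: mult_left_mono)
    finally show ?case by simp
  qed (simp add: P0 norm_blinfun_id_le)
  then have P: "summable P"
    using assms by (intro summable_comparison_test'[OF summable_geometric[of "norm K"]]) auto
  define S where "S = suminf P"
  have S: "S = (\<Sum>n. P (Suc n)) + id_blinfun"
    using suminf_split_head[OF P] by (simp add: S_def P0)
  have "K o\<^sub>L S = (\<Sum>n. P (Suc n))"
    unfolding S_def PS
    by (rule bounded_linear.suminf[OF
          bounded_bilinear.bounded_linear_right[OF bounded_bilinear_blinfun_compose] P])
  moreover have "S o\<^sub>L K = (\<Sum>n. P (Suc n))"
    unfolding S_def PS'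
    by (rule bounded_linear.suminf[OF
          bounded_bilinear.bounded_linear_left[OF bounded_bilinear_blinfun_compose] P])
  ultimately have "S = (K o\<^sub>L S) + id_blinfun" "S = (S o\<^sub>L K) + id_blinfun" using S by simp_all
  then have "S x = K (S x) + x" "S x = S (K x) + x" for x
    by (metis blinfun.add_left blinfun_apply_blinfun_compose blinfun_apply_id_blinfun id_apply)+
  then have "S x - K (S x) = x" "S x - S (K x) = x" for x
    by (metis add_diff_cancel_left')+
  then show thesis by (intro that[of S]) (simp_all add: blinfun.diff_right)
qed

text \<open>For larger \<open>t\<close>, write \<open>T - t = -t (1 - T/t)\<close> and invert by the
  Neumann series. This places the real spectrum in a compact interval, where polynomial
  approximation is available.\<close>

lemma spectrum_op_real_bound:
  fixes T :: "'a::complex_hilbert \<Rightarrow>\<^sub>L 'a"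
  assumes "complex_of_real t \<in> spectrum_op T"
  shows "\<bar>t\<bar> \<le> norm T"
proof (rule ccontr)
  assume *: "\<not> \<bar>t\<bar> \<le> norm T"
  then have "t \<noteq> 0" by (metis abs_zero norm_ge_zero)
  have "norm ((1 / t) *\<^sub>R T) < 1" using * \<open>t \<noteq> 0\<close> by (simp add: field_simps)
  then obtain S :: "'a \<Rightarrow>\<^sub>L 'a" where "\<And>x. S (x - ((1 / t) *\<^sub>R T) x) = x"
    "\<And>x. S x - ((1 / t) *\<^sub>R T) (S x) = x"
    using neumann_inverse by blast
  note S = this[unfolded blinfun.scaleR_left]
  let ?S = "- (1 / t) *\<^sub>R S"
  have "T x - t *\<^sub>R x = - t *\<^sub>R (x - (1 / t) *\<^sub>R T x)" for x
    using \<open>t \<noteq> 0\<close> by (simp add: algebra_simps)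
  moreover have "?S (- t *\<^sub>R y) = S y" for y
    using \<open>t \<noteq> 0\<close> by (simp add: blinfun.bilinear_simps)
  ultimately have "?S (T x - t *\<^sub>R x) = x" for x
    by (simp only: S(1))
  moreover have "T (?S x) - t *\<^sub>R ?S x = x" for x
    using S(2)[of x] \<open>t \<noteq> 0\<close> by (simp add: blinfun.bilinear_simps algebra_simps)
  ultimately show False
    using assms unfolding spectrum_op_def mem_Collect_eq scaleR_scaleC[symmetric] by blast
qed

section \<open>The continuous functional calculus\<close>

lemma uniform_poly_approximation:
  fixes f :: "real \<Rightarrow> real"
  assumes "compact K" "continuous_on K f"
  obtains q :: "nat \<Rightarrow> real poly" where "uniform_limit K (\<lambda>n. poly (q n)) f sequentially"
proof -
  have "\<exists>q. \<forall>t\<in>K. \<bar>f t - poly q t\<bar> < inverse (real (Suc n))" for n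
  proof -
    obtain g where g: "real_polynomial_function g" "\<And>t. t \<in> K \<Longrightarrow> \<bar>f t - g t\<bar> < inverse (real (Suc n))"
      using Stone_Weierstrass_real_polynomial_function[OF assms, of "inverse (real (Suc n))"] by auto
    then obtain a m where "g = (\<lambda>t. \<Sum>i\<le>m. a i * t ^ i)"
      by (auto simp: real_polynomial_function_iff_sum)
    then have "g = poly (\<Sum>i\<le>m. monom (a i) i)"
      by (simp add: poly_sum poly_monom fun_eq_iff)
    with g show ?thesis by blast
  qed
  then obtain q where q: "\<And>n t. t \<in> K \<Longrightarrow> \<bar>f t - poly (q n) t\<bar> < inverse (real (Suc n))"
    by metis
  have "uniform_limit K (\<lambda>n. poly (q n)) f sequentially"
  proof (rule uniform_limitI)
    fix e :: real assume "e > 0"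
    with LIMSEQ_inverse_real_of_nat have "\<forall>\<^sub>F n in sequentially. inverse (real (Suc n)) < e"
      by (rule order_tendstoD)
    then show "\<forall>\<^sub>F n in sequentially. \<forall>t\<in>K. dist (poly (q n) t) (f t) < e"
      by eventually_elim (metis dist_commute dist_real_def less_trans q)
  qed
  then show thesis by (rule that)
qed

text \<open>The norm is the value of \<open>\<bar>p - q\<bar>\<close> at one real spectral point,
  where both polynomials are within \<open>e\<close> of \<open>f\<close>. This gives both
  convergence and uniqueness in the functional calculus.\<close>

lemma norm_poly_op_diff_le:
  fixes T :: "'a::complex_hilbert \<Rightarrow>\<^sub>L 'a"
  assumes "\<exists>x::'a. x \<noteq> 0" "self_adjoint T"
    and "\<And>t. complex_of_real t \<in> spectrum_op T \<Longrightarrow> dist (poly p t) (f t) < e"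
    and "\<And>t. complex_of_real t \<in> spectrum_op T \<Longrightarrow> dist (poly q t) (f t) < e"
  shows "norm (poly_op p T - poly_op q T) < 2 * e"
proof -
  obtain t where t: "\<not> bounded_below (T - t *\<^sub>R id_blinfun)"
    "\<bar>poly (p - q) t\<bar> = norm (poly_op (p - q) T)"
    using norm_poly_op_attained[OF assms(1,2)] by metis
  have "complex_of_real t \<in> spectrum_op T"
    using t(1) by (rule not_bounded_below_in_spectrum)
  then show ?thesis
    using t(2) assms(3)[of t] assms(4)[of t] by (simp add: poly_op_diff dist_real_def)
qed

text \<open>Resolves the definite description in \<open>cfc\<close>: approximation on the whole
  interval and completeness give a limit, and the norm estimate shows that all approximating
  sequences share it.\<close>

lemma cfc_approximation:
  fixes T :: "'a::complex_hilbert \<Rightarrow>\<^sub>L 'a"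
  assumes nontrivial: "\<exists>x::'a. x \<noteq> 0" and sa: "self_adjoint T"
    and f: "continuous_on {-norm T..norm T} f"
  obtains q where "uniform_limit {t. complex_of_real t \<in> spectrum_op T} (\<lambda>n. poly (q n)) f sequentially"
    "(\<lambda>n. poly_op (q n) T) \<longlonglongrightarrow> cfc f T"
proof -
  let ?\<sigma> = "{t. complex_of_real t \<in> spectrum_op T}"
  obtain q :: "nat \<Rightarrow> real poly" where "uniform_limit {-norm T..norm T} (\<lambda>n. poly (q n)) f sequentially"
    using uniform_poly_approximation[OF _ f] by blast
  then have q: "uniform_limit ?\<sigma> (\<lambda>n. poly (q n)) f sequentially"
    by (rule uniform_limit_on_subset) (use spectrum_op_real_bound in fastforce)
  have near: "\<forall>\<^sub>F n in sequentially. \<forall>t. complex_of_real t \<in> spectrum_op T \<longrightarrow> dist (poly (r n) t) (f t) < e"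
    if "uniform_limit ?\<sigma> (\<lambda>n. poly (r n)) f sequentially" "e > 0" for r :: "nat \<Rightarrow> real poly" and e
    using uniform_limitD[OF that] by simp
  have "Cauchy (\<lambda>n. poly_op (q n) T)"
  proof (rule metric_CauchyI)
    fix e :: real assume "e > 0"
    then obtain N where N: "\<And>n t. n \<ge> N \<Longrightarrow> complex_of_real t \<in> spectrum_op T \<Longrightarrow> dist (poly (q n) t) (f t) < e / 2"
      using near[OF q, of "e / 2"] by (auto simp: eventually_sequentially)
    have "dist (poly_op (q m) T) (poly_op (q n) T) < e" if "m \<ge> N" "n \<ge> N" for m n
      using norm_poly_op_diff_le[OF nontrivial sa N[OF that(1)] N[OF that(2)]] by (simp add: dist_norm)
    then show "\<exists>N. \<forall>m\<ge>N. \<forall>n\<ge>N. dist (poly_op (q m) T) (poly_op (q n) T) < e" by blast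
  qed
  then obtain S where S: "(\<lambda>n. poly_op (q n) T) \<longlonglongrightarrow> S"
    by (auto simp: Cauchy_convergent_iff convergent_def)
  have "cfc f T = S"
    unfolding cfc_def
  proof (rule the_equality)
    show "\<exists>q. uniform_limit ?\<sigma> (\<lambda>n. poly (q n)) f sequentially \<and> (\<lambda>n. poly_op (q n) T) \<longlonglongrightarrow> S"
      using q S by blast
    fix S' assume "\<exists>q. uniform_limit ?\<sigma> (\<lambda>n. poly (q n)) f sequentially \<and> (\<lambda>n. poly_op (q n) T) \<longlonglongrightarrow> S'"
    then obtain r where r: "uniform_limit ?\<sigma> (\<lambda>n. poly (r n)) f sequentially" "(\<lambda>n. poly_op (r n) T) \<longlonglongrightarrow> S'"
      by blast
    have "(\<lambda>n. poly_op (r n) T - poly_op (q n) T) \<longlonglongrightarrow> 0"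
    proof (rule tendstoI)
      fix e :: real assume "e > 0"
      then have "e / 2 > 0" by simp
      from near[OF r(1) this] near[OF q this]
      show "\<forall>\<^sub>F n in sequentially. dist (poly_op (r n) T - poly_op (q n) T) 0 < e"
      proof eventually_elim
        case (elim n)
        then show ?case
          using norm_poly_op_diff_le[OF nontrivial sa, of "r n" f "e / 2" "q n"] by simp
      qed
    qed
    moreover have "(\<lambda>n. poly_op (r n) T - poly_op (q n) T) \<longlonglongrightarrow> S' - S"
      using r(2) S by (rule tendsto_diff)
    ultimately show "S' = S" using LIMSEQ_unique by fastforce
  qed
  with q S that show thesis by blast
qed

text \<open>Allows the calculus to be applied a second time, to \<open>abs_op\<close>.\<close>

lemma self_adjoint_cfc:
  fixes T :: "'a::complex_hilbert \<Rightarrow>\<^sub>L 'a"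
  assumes "\<exists>x::'a. x \<noteq> 0" "self_adjoint T" "continuous_on {-norm T..norm T} f"
  shows "self_adjoint (cfc f T)"
  by (rule cfc_approximation[OF assms]) (rule self_adjoint_limit[OF self_adjoint_poly_op[OF assms(2)]])

text \<open>The factor \<open>[:-t, 1:]\<close> divides \<open>q - q(t)\<close>, so the difference
  is a fixed bounded operator applied to \<open>T (X n) - t X n\<close>.\<close>

lemma poly_op_approx_eigenvector:
  fixes T :: "'a::complex_hilbert \<Rightarrow>\<^sub>L 'a"
  assumes "(\<lambda>n. T (X n) - t *\<^sub>R X n) \<longlonglongrightarrow> 0"
  shows "(\<lambda>n. poly_op q T (X n) - poly q t *\<^sub>R X n) \<longlonglongrightarrow> 0"
proof -
  have "poly (q - [:poly q t:]) t = 0" by simp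
  then obtain h where "q - [:poly q t:] = h * [:-t, 1:]"
    by (metis dvdE mult.commute poly_eq_0_iff_dvd)
  then have "poly_op (q - [:poly q t:]) T x = poly_op h T (poly_op [:-t, 1:] T x)" for x
    by (simp only: poly_op_mult)
  then have "poly_op q T x - poly q t *\<^sub>R x = poly_op h T (T x - t *\<^sub>R x)" for x
    by (simp add: poly_op_diff poly_op_pCons blinfun.bilinear_simps)
  then show ?thesis
    using blinfun.tendsto[OF tendsto_const assms, of "poly_op h T"] by (simp add: blinfun.zero_right)
qed

text \<open>An \<open>e/3\<close> argument: one polynomial close to \<open>f\<close> is fixed, then
  the polynomial case is applied.\<close>

lemma cfc_approx_eigenvector:
  fixes T :: "'a::complex_hilbert \<Rightarrow>\<^sub>L 'a"
  assumes nontrivial: "\<exists>x::'a. x \<noteq> 0" and sa: "self_adjoint T"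
    and f: "continuous_on {-norm T..norm T} f"
    and X: "\<And>n. norm (X n) = 1" "(\<lambda>n. T (X n) - t *\<^sub>R X n) \<longlonglongrightarrow> 0"
  shows "(\<lambda>n. cfc f T (X n) - f t *\<^sub>R X n) \<longlonglongrightarrow> 0"
proof (rule tendstoI)
  fix e :: real assume "e > 0"
  obtain q where q: "uniform_limit {t. complex_of_real t \<in> spectrum_op T} (\<lambda>n. poly (q n)) f sequentially"
    "(\<lambda>n. poly_op (q n) T) \<longlonglongrightarrow> cfc f T"
    by (rule cfc_approximation[OF nontrivial sa f])
  \<comment> \<open>Uniform convergence is known only on the spectrum, so \<open>t\<close> must
    first be placed there.\<close>
  have "\<not> bounded_below (T - t *\<^sub>R id_blinfun)"
  proof
    assume "bounded_below (T - t *\<^sub>R id_blinfun)"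
    then obtain c where c: "c > 0" "\<And>x. c * norm x \<le> norm (T x - t *\<^sub>R x)"
      by (auto simp: bounded_below_def blinfun.bilinear_simps)
    then have "\<forall>\<^sub>F n in sequentially. norm (T (X n) - t *\<^sub>R X n) < c"
      using tendstoD[OF X(2)] by simp
    then obtain n where "norm (T (X n) - t *\<^sub>R X n) < c"
      using eventually_happens by fastforce
    then show False using c(2)[of "X n"] X(1) by simp
  qed
  then have t: "complex_of_real t \<in> spectrum_op T" by (rule not_bounded_below_in_spectrum)
  have "e / 3 > 0" using \<open>e > 0\<close> by simp
  have "\<forall>\<^sub>F m in sequentially. dist (poly (q m) t) (f t) < e / 3 \<and> dist (poly_op (q m) T) (cfc f T) < e / 3"
    using eventually_conj[OF uniform_limitD[OF q(1) \<open>e / 3 > 0\<close>] tendstoD[OF q(2) \<open>e / 3 > 0\<close>]]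
    by eventually_elim (use t in auto)
  then obtain m where m: "dist (poly (q m) t) (f t) < e / 3" "dist (poly_op (q m) T) (cfc f T) < e / 3"
    using eventually_happens by fastforce
  have "\<forall>\<^sub>F n in sequentially. norm (poly_op (q m) T (X n) - poly (q m) t *\<^sub>R X n) < e / 3"
    using tendstoD[OF poly_op_approx_eigenvector[OF X(2)] \<open>e / 3 > 0\<close>, of "q m"] by simp
  then show "\<forall>\<^sub>F n in sequentially. dist (cfc f T (X n) - f t *\<^sub>R X n) 0 < e"
  proof eventually_elim
    case (elim n)
    have "norm ((cfc f T - poly_op (q m) T) (X n)) < e / 3"
      using norm_blinfun[of "cfc f T - poly_op (q m) T" "X n"] m(2) X(1)[of n]
      by (simp add: dist_norm norm_minus_commute)
    moreover have "norm ((poly (q m) t - f t) *\<^sub>R X n) < e / 3"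
      using m(1) X(1)[of n] by (simp add: dist_real_def)
    moreover have "cfc f T (X n) - f t *\<^sub>R X n = (cfc f T - poly_op (q m) T) (X n)
        + (poly_op (q m) T (X n) - poly (q m) t *\<^sub>R X n) + (poly (q m) t - f t) *\<^sub>R X n"
      by (simp add: blinfun.bilinear_simps algebra_simps)
    ultimately show ?case
      using elim norm_triangle_ineq[of "(cfc f T - poly_op (q m) T) (X n)
        + (poly_op (q m) T (X n) - poly (q m) t *\<^sub>R X n)" "(poly (q m) t - f t) *\<^sub>R X n"]
        norm_triangle_ineq[of "(cfc f T - poly_op (q m) T) (X n)" "poly_op (q m) T (X n) - poly (q m) t *\<^sub>R X n"]
      by (simp add: dist_norm)
  qed
qed

section \<open>The norm is an approximate eigenvalue\<close>

text \<open>Since \<open>ln (- t) = ln t\<close>, the function \<open>\<lambda>t. t powr p\<close> is even, so self-adjointness suffices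
  below where positivity would be expected.\<close>

lemma continuous_on_powr_const:
  assumes "p > 0"
  shows "continuous_on K (\<lambda>t::real. t powr p)"
proof -
  have "t powr p = \<bar>t\<bar> powr p" for t :: real
    by (cases "t \<ge> 0") (simp_all add: powr_def ln_minus)
  moreover have "continuous_on K (\<lambda>t::real. \<bar>t\<bar> powr p)"
    using assms by (intro continuous_on_powr' continuous_intros) auto
  ultimately show ?thesis by simp
qed

text \<open>Some \<open>t\<close> with \<open>\<bar>t\<bar> = norm A\<close> is an approximate
  eigenvalue. A negative \<open>t\<close> is impossible: the quadratic form of \<open>A - t\<close>
  would be at least \<open>-t > 0\<close> on unit vectors.\<close>

lemma positive_op_not_bounded_below_norm:
  fixes A :: "'a::complex_hilbert \<Rightarrow>\<^sub>L 'a"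
  assumes nontrivial: "\<exists>x::'a. x \<noteq> 0" and A: "positive_op A"
  shows "\<not> bounded_below (A - norm A *\<^sub>R id_blinfun)"
proof -
  have "poly_op [:0, 1:] A = A"
    by (rule blinfun_eqI) (simp add: poly_op_pCons)
  then obtain t where t: "\<not> bounded_below (A - t *\<^sub>R id_blinfun)" "\<bar>t\<bar> = norm A"
    using norm_poly_op_attained[OF nontrivial positive_op_self_adjoint[OF A], of "[:0, 1:]"] by auto
  have "t \<ge> 0"
  proof (rule ccontr)
    assume "\<not> t \<ge> 0"
    moreover have "Re (cinner (A x) x) \<ge> 0" for x
      using A by (auto simp: positive_op_def complex_nonneg_Reals_iff)
    then have "- t * (norm x)\<^sup>2 \<le> Re (cinner ((A - t *\<^sub>R id_blinfun) x) x)" for x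
      by (simp add: blinfun.bilinear_simps cinner_simps cinner_self)
    ultimately have "bounded_below (A - t *\<^sub>R id_blinfun)"
      by (intro bounded_below_cinnerI[of "- t"]) auto
    with t(1) show False ..
  qed
  with t show ?thesis by simp
qed

text \<open>On approximate eigenvectors of \<open>A\<close> at \<open>norm A\<close>, the power acts
  nearly as the scalar \<open>norm A powr p\<close>.\<close>

lemma norm_powr_op_ge:
  fixes A :: "'a::complex_hilbert \<Rightarrow>\<^sub>L 'a"
  assumes nontrivial: "\<exists>x::'a. x \<noteq> 0" and A: "positive_op A" and "p > 0"
  shows "norm A powr p \<le> norm (powr_op A p)"
proof -
  obtain X where X: "\<And>n. norm (X n) = 1" "(\<lambda>n. (A - norm A *\<^sub>R id_blinfun) (X n)) \<longlonglongrightarrow> 0"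
    using not_bounded_below_sequence[OF positive_op_not_bounded_below_norm[OF nontrivial A]] by blast
  then have "(\<lambda>n. A (X n) - norm A *\<^sub>R X n) \<longlonglongrightarrow> 0"
    by (simp add: blinfun.bilinear_simps)
  then have lim: "(\<lambda>n. norm (powr_op A p (X n) - (norm A powr p) *\<^sub>R X n)) \<longlonglongrightarrow> 0"
    unfolding powr_op_def
    by (intro tendsto_norm_zero cfc_approx_eigenvector nontrivial X continuous_on_powr_const
        positive_op_self_adjoint A \<open>p > 0\<close>)
  have "norm A powr p - norm (powr_op A p) \<le> norm (powr_op A p (X n) - (norm A powr p) *\<^sub>R X n)" for n
    using norm_triangle_ineq2[of "(norm A powr p) *\<^sub>R X n" "powr_op A p (X n)"]
      norm_blinfun[of "powr_op A p" "X n"] X(1)[of n] by (simp add: norm_minus_commute)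
  then have "norm A powr p - norm (powr_op A p) \<le> 0"
    by (intro tendsto_lowerbound[OF lim]) auto
  then show ?thesis by simp
qed

lemma lower_bound_op_le_0:
  fixes T :: "'a::complex_hilbert \<Rightarrow>\<^sub>L 'a"
  assumes "\<And>n. norm (X n) = 1" "(\<lambda>n. T (X n)) \<longlonglongrightarrow> 0"
  shows "lower_bound_op T \<le> 0"
proof (rule tendsto_lowerbound[OF tendsto_norm_zero[OF assms(2)]])
  have "lower_bound_op T \<le> norm (T (X n))" for n
    unfolding lower_bound_op_def by (rule cINF_lower) (auto simp: assms(1) intro!: bdd_belowI[of _ 0])
  then show "\<forall>\<^sub>F n in sequentially. lower_bound_op T \<le> norm (T (X n))" by simp
qed simp

text \<open>Approximate eigenvectors of \<open>A\<close> at \<open>norm A\<close> are approximate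
  null vectors of \<open>?D\<close>, hence in turn of its square, its absolute value and the power
  of that.\<close>

lemma lower_bound_op_abs_powr_le_0:
  fixes A :: "'a::complex_hilbert \<Rightarrow>\<^sub>L 'a"
  assumes nontrivial: "\<exists>x::'a. x \<noteq> 0" and A: "positive_op A" and "p > 0"
  shows "lower_bound_op (powr_op (abs_op (A - norm A *\<^sub>R id_blinfun)) p) \<le> 0"
proof -
  let ?D = "A - norm A *\<^sub>R id_blinfun"
  obtain X where X: "\<And>n. norm (X n) = 1" "(\<lambda>n. ?D (X n)) \<longlonglongrightarrow> 0"
    using not_bounded_below_sequence[OF positive_op_not_bounded_below_norm[OF nontrivial A]] by blast
  have D: "self_adjoint ?D"
    by (intro self_adjoint_diff_id positive_op_self_adjoint A)
  then have DD: "self_adjoint (?D o\<^sub>L ?D)"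
    by (simp add: self_adjoint_def)
  have root: "continuous_on K (\<lambda>t::real. t powr (1 / 2))" for K
    by (rule continuous_on_powr_const) simp
  have abs: "abs_op ?D = cfc (\<lambda>t. t powr (1 / 2)) (?D o\<^sub>L ?D)"
    by (simp add: abs_op_def powr_op_def adjoint_op_self_adjoint[OF D])
  have "(\<lambda>n. (?D o\<^sub>L ?D) (X n) - 0 *\<^sub>R X n) \<longlonglongrightarrow> 0"
    using blinfun.tendsto[OF tendsto_const X(2), of ?D] by (simp add: blinfun.zero_right)
  \<comment> \<open>The eigenvalue 0 is kept because \<open>0 powr (1/2) = 0\<close>; likewise for
    the exponent \<open>p\<close> below.\<close>
  from cfc_approx_eigenvector[OF nontrivial DD root X(1) this]
  have 1: "(\<lambda>n. abs_op ?D (X n) - 0 *\<^sub>R X n) \<longlonglongrightarrow> 0"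
    by (simp add: abs)
  have "self_adjoint (abs_op ?D)"
    unfolding abs by (rule self_adjoint_cfc[OF nontrivial DD root])
  from cfc_approx_eigenvector[OF nontrivial this continuous_on_powr_const[OF \<open>p > 0\<close>] X(1) 1]
  have "(\<lambda>n. powr_op (abs_op ?D) p (X n)) \<longlonglongrightarrow> 0"
    by (simp add: powr_op_def)
  with X(1) show ?thesis by (rule lower_bound_op_le_0)
qed

section \<open>The numerical radius and the final estimate\<close>

lemma numerical_radius_bounds:
  fixes T :: "'a::complex_hilbert \<Rightarrow>\<^sub>L 'a"
  assumes "\<exists>x::'a. x \<noteq> 0"
  shows "0 \<le> numerical_radius T" "numerical_radius T \<le> norm T"
proof -
  \<comment> \<open>Normalizing \<open>y\<close> shows that the supremum ranges over a nonempty
    set.\<close>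
  obtain y :: 'a where "y \<noteq> 0" using assms by blast
  then have y: "sgn y \<in> {x. norm x = 1}" by (simp add: norm_sgn)
  have le: "cmod (cinner (T x) x) \<le> norm T" if "x \<in> {x. norm x = 1}" for x
    using that order_trans[OF cinner_Cauchy_Schwarz[of "T x" x]] norm_blinfun[of T x] by simp
  show "numerical_radius T \<le> norm T"
    unfolding numerical_radius_def by (rule cSUP_least) (use y le in auto)
  have "cmod (cinner (T (sgn y)) (sgn y)) \<le> numerical_radius T"
    unfolding numerical_radius_def
    by (rule cSUP_upper[OF y]) (use le in \<open>auto intro!: bdd_aboveI\<close>)
  then show "0 \<le> numerical_radius T"
    using norm_ge_zero order_trans by blast
qed

text \<open>The contraction hypothesis enters here: for a base in \<open>[0, 1]\<close>, lowering
  the exponent from \<open>2 * p\<close> to \<open>p\<close> can only increase the power.\<close>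

lemma numerical_radius_powr_le:
  fixes T :: "'a::complex_hilbert \<Rightarrow>\<^sub>L 'a"
  assumes "\<exists>x::'a. x \<noteq> 0" "norm T \<le> 1" "p > 0"
  shows "numerical_radius T powr (2 * p) \<le> norm T powr p"
proof -
  have "numerical_radius T powr (2 * p) \<le> norm T powr (2 * p)"
    using numerical_radius_bounds[OF assms(1), of T] assms(3) by (intro powr_mono2) auto
  also have "\<dots> \<le> norm T powr p"
    using assms(2,3) by (intro powr_mono') auto
  finally show ?thesis .
qed

theorem theorem4:
  assumes nontrivial: "\<exists>x :: 'a::complex_hilbert. x \<noteq> 0"
  shows "(\<forall>(A :: 'a \<Rightarrow>\<^sub>L 'a) (B :: 'a \<Rightarrow>\<^sub>L 'a) (p::real).
            positive_op A \<longrightarrow> positive_op B \<longrightarrow> norm (A o\<^sub>L B) \<le> 1 \<longrightarrow> p \<ge> 2 \<longrightarrow>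
            numerical_radius (A o\<^sub>L B) powr (2 * p)
              \<le> (norm (powr_op A p)
                   - lower_bound_op (powr_op (abs_op (A - norm A *\<^sub>R id_blinfun)) p))
                * (norm (powr_op B p)
                   - lower_bound_op (powr_op (abs_op (B - norm B *\<^sub>R id_blinfun)) p)))
       \<and> (\<forall>(A :: 'a \<Rightarrow>\<^sub>L 'a) (p::real).
            positive_op A \<longrightarrow> norm A \<le> 1 \<longrightarrow> p \<ge> 2 \<longrightarrow>
            numerical_radius A powr (2 * p)
              \<le> norm (powr_op A p)
                - lower_bound_op (powr_op (abs_op (A - norm A *\<^sub>R id_blinfun)) p))"
proof -
  define F where "F A p = norm (powr_op A p)
    - lower_bound_op (powr_op (abs_op (A - norm A *\<^sub>R id_blinfun)) p)"
    for A :: "'a \<Rightarrow>\<^sub>L 'a" and p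
  have F: "norm A powr p \<le> F A p" if "positive_op A" "p \<ge> 2" for A p
    using norm_powr_op_ge[OF nontrivial, of A p] lower_bound_op_abs_powr_le_0[OF nontrivial, of A p]
      that by (simp add: F_def)
  have "numerical_radius (A o\<^sub>L B) powr (2 * p) \<le> F A p * F B p"
    if "positive_op A" "positive_op B" "norm (A o\<^sub>L B) \<le> 1" "p \<ge> 2" for A B p
  proof -
    have "numerical_radius (A o\<^sub>L B) powr (2 * p) \<le> norm (A o\<^sub>L B) powr p"
      using that by (intro numerical_radius_powr_le nontrivial) auto
    also have "\<dots> \<le> (norm A * norm B) powr p"
      using that by (intro powr_mono2 norm_blinfun_compose) auto
    also have "\<dots> = norm A powr p * norm B powr p" by (simp add: powr_mult)
    also have "\<dots> \<le> F A p * F B p"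
      \<comment> \<open>Multiplying the two bounds requires \<open>F A p\<close> to be nonnegative,
        which follows from its lower bound.\<close>
      using F[of A p] F[of B p] that order_trans[OF powr_ge_zero F[of A p]]
      by (intro mult_mono) auto
    finally show ?thesis .
  qed
  \<comment> \<open>Obtained directly from the one-operator bound, not by putting the identity for
    \<open>B\<close>.\<close>
  moreover have "numerical_radius A powr (2 * p) \<le> F A p"
    if "positive_op A" "norm A \<le> 1" "p \<ge> 2" for A p
    using numerical_radius_powr_le[OF nontrivial, of A p] F[of A p] that by simp
  ultimately show ?thesis
    unfolding F_def by blast
qed

end
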